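(* Let $C=\bigcup_i C_i$ be a union of conjugacy classes of the symmetric group $S_n$. Then the conjugation quandle $\mathrm{Conj}(S_n,C)$ satisfies the Hayashi property.
   Context: For a group $G$ and a conjugation-closed subset $C\subseteq G$, the conjugation quandle $\mathrm{Conj}(G,C)$ is the set $C$ with the binary operation $x\triangleright y=yxy^{-1}$. For $y\in C$ the right translation is the permutation $R_y:C\to C$, $R_y(x)=x\triangleright y=yxy^{-1}$. A permutation of a finite set whose disjoint cycles (fixed points included as cycles of length $1$) have the distinct lengths $\lambda_1<\lambda_2<\dots<\lambda_t$ is called regular if $\lambda_i$ divides $\lambda_t$ for all $1\le i\le t$. A finite quandle satisfies the Hayashi property if all of its right translations are regular permutations. *)

theory Defs
  imports "HOL-Algebra.Sym_Groups" "HOL-Algebra.Group_Action" "HOL-Combinatorics.Orbits"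
begin

definition conjugacy_classes :: "('a, 'b) monoid_scheme \<Rightarrow> 'a set set" where
  "conjugacy_classes G =
     orbits G (carrier G) (\<lambda>g. \<lambda>h \<in> carrier G. g \<otimes>\<^bsub>G\<^esub> h \<otimes>\<^bsub>G\<^esub> inv\<^bsub>G\<^esub> g)"

record 'a quandle =
  elts :: "'a set"
  op :: "'a \<Rightarrow> 'a \<Rightarrow> 'a"

text \<open>
  Quandles are right-handed here: the right translations \<open>x \<mapsto> op Q x y\<close> are the
  automorphisms. Outside \<open>elts Q\<close> the right translation is the identity, so that it is a
  permutation in the sense of \<open>permutes\<close>.
\<close>

definition right_translation :: "('a, 'b) quandle_scheme \<Rightarrow> 'a \<Rightarrow> 'a \<Rightarrow> 'a" where
  "right_translation Q y = perm_restrict (\<lambda>x. op Q x y) (elts Q)"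

locale finite_quandle =
  fixes Q :: "('a, 'b) quandle_scheme"
  assumes finite_elts: "finite (elts Q)"
    and op_closed: "\<lbrakk>x \<in> elts Q; y \<in> elts Q\<rbrakk> \<Longrightarrow> op Q x y \<in> elts Q"
    and op_idem: "x \<in> elts Q \<Longrightarrow> op Q x x = x"
    and right_translation_permutes: "y \<in> elts Q \<Longrightarrow> right_translation Q y permutes elts Q"
    and op_right_distrib: "\<lbrakk>x \<in> elts Q; y \<in> elts Q; z \<in> elts Q\<rbrakk> \<Longrightarrow>
      op Q (op Q x y) z = op Q (op Q x z) (op Q y z)"

definition conj_quandle :: "('a, 'b) monoid_scheme \<Rightarrow> 'a set \<Rightarrow> 'a quandle" where
  "conj_quandle G C = \<lparr>elts = C, op = (\<lambda>x y. y \<otimes>\<^bsub>G\<^esub> x \<otimes>\<^bsub>G\<^esub> inv\<^bsub>G\<^esub> y)\<rparr>"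

text \<open>
  For a permutation of a finite set \<open>S\<close>, \<open>Orbits.orbit f x\<close> is the underlying set of the cycle
  of \<open>f\<close> through \<open>x\<close>; it is \<open>{x}\<close> if \<open>x\<close> is a fixed point.
\<close>

definition cycle_lengths :: "('a \<Rightarrow> 'a) \<Rightarrow> 'a set \<Rightarrow> nat set" where
  "cycle_lengths f S = (\<lambda>x. card (Orbits.orbit f x)) ` S"

definition regular_permutation :: "('a \<Rightarrow> 'a) \<Rightarrow> 'a set \<Rightarrow> bool" where
  "regular_permutation f S \<longleftrightarrow>
     finite S \<and> f permutes S \<and> (\<forall>l \<in> cycle_lengths f S. l dvd Max (cycle_lengths f S))"

definition hayashi :: "('a, 'b) quandle_scheme \<Rightarrow> bool" where
  "hayashi Q \<longleftrightarrow> finite_quandle Q \<and>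
     (\<forall>y \<in> elts Q. regular_permutation (right_translation Q y) (elts Q))"

end

theory Submission
  imports Defs
begin

text \<open>
  The cycle of conjugation by \<open>y\<close> through \<open>x\<close> has length dividing \<open>k\<close> iff \<open>y ^^ k\<close> commutes
  with \<open>x\<close>. So it suffices to find a conjugate \<open>x = f y f\<inverse>\<close> of \<open>y\<close>, which lies in \<open>C\<close> along with
  \<open>y\<close>, that commutes with no nontrivial power \<open>z\<close> of \<open>y\<close>; equivalently, \<open>f\<inverse> z f\<close> does not
  commute with \<open>y\<close>. If \<open>y\<close> has at least two nontrivial cycles and is not an involution, let \<open>f\<close>
  permute cyclically one representative of each of them. If it has a single cycle, of length at
  least \<open>5\<close>, let \<open>f\<close> transpose two adjacent points of it: then \<open>f\<inverse> z f\<close> and \<open>z\<close> differ on at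
  most four points, but commutation with \<open>y\<close> forces them to differ on whole cycles of \<open>y\<close>. In the
  remaining cases \<open>y\<close> has order at most \<open>4\<close>, and the divisors of such a number form a chain.
\<close>

section \<open>Cyclic permutations, cycle lengths and representatives of cycles\<close>

text \<open>Having no proper nonempty invariant subset characterizes a single cycle through all of
  \<open>R\<close>. The induction lengthens such a cycle by one point.\<close>

lemma exists_cyclic_permutation:
  assumes "finite R" "R \<noteq> {}"
  shows "\<exists>f. f permutes R \<and> (\<forall>P\<subseteq>R. P \<noteq> {} \<longrightarrow> f ` P \<subseteq> P \<longrightarrow> P = R)"
  using assms
proof (induction R rule: finite_ne_induct)
  case (singleton a)
  then show ?case by (intro exI[of _ id]) (auto simp: permutes_id)
next
  case (insert a R)
  then obtain f where f: "f permutes R"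
    and min: "\<And>P. P \<subseteq> R \<Longrightarrow> P \<noteq> {} \<Longrightarrow> f ` P \<subseteq> P \<Longrightarrow> P = R" by metis
  obtain b where b: "b \<in> R" using insert by blast
  \<comment> \<open>This splices \<open>a\<close> into the cycle of \<open>f\<close> between
    \<open>b\<close> and \<open>f b\<close>.\<close>
  define f' where "f' = f \<circ> transpose a b"
  have f'_a: "f' a = f b" and f'_b: "f' b = a"
    using f insert.hyps by (auto simp: f'_def permutes_not_in)
  have f'_else: "f' x = f x" if "x \<noteq> a" "x \<noteq> b" for x
    using that by (simp add: f'_def)
  have fR: "f x \<in> R \<longleftrightarrow> x \<in> R" for x using permutes_in_image[OF f] .
  have "f' permutes insert a R" unfolding f'_def
    by (meson b f insertCI permutes_compose permutes_subset permutes_swap_id subset_insertI)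
  moreover have "P = insert a R" if P: "P \<subseteq> insert a R" "P \<noteq> {}" "f' ` P \<subseteq> P" for P
  proof -
    have step: "f' x \<in> P" if "x \<in> P" for x using P that by auto
    \<comment> \<open>Dropping \<open>a\<close> loses nothing: if \<open>b\<close> is in
      \<open>P\<close>, then so are \<open>a\<close> and the next point \<open>f b\<close>.\<close>
    have "f ` (P - {a}) \<subseteq> P - {a}"
    proof (rule image_subsetI)
      fix x assume x: "x \<in> P - {a}"
      then have "f x \<in> P"
        using step[of x] step[of a] f'_a f'_b f'_else[of x] by (cases "x = b") auto
      moreover have "f x \<noteq> a" using fR[of x] x P insert.hyps by auto
      ultimately show "f x \<in> P - {a}" by blast
    qed
    moreover have "P - {a} \<noteq> {}"
    proof
      assume "P - {a} = {}"
      then have "P = {a}" using P by auto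
      then show False using step[of a] f'_a fR[of b] b insert.hyps by auto
    qed
    ultimately have "P - {a} = R" using min[of "P - {a}"] P by auto
    then show ?thesis using step[of b] f'_b b by auto
  qed
  ultimately show ?case by blast
qed

text \<open>The size of the orbit is the first positive return time \<open>d\<close>, and the return
  times are exactly the multiples of \<open>d\<close>.\<close>

lemma card_orbit_dvd_iff:
  assumes "permutation f"
  shows "card (Orbits.orbit f x) dvd k \<longleftrightarrow> (f ^^ k) x = x"
proof -
  have x: "x \<in> Orbits.orbit f x" by (rule permutation_self_in_orbit[OF assms])
  define d where "d = funpow_dist1 f x x"
  have "card (Orbits.orbit f x) = d"
    using inj_on_funpow_dist1[OF x] unfolding orbit_conv_funpow_dist1[OF x] d_def
    by (simp add: card_image)
  moreover have "(f ^^ d) x = x" using funpow_dist1_prop[OF x] unfolding d_def .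
  moreover have "(f ^^ k) x \<noteq> x" if "0 < k" "k < d" for k
    using funpow_dist1_least[OF that[unfolded d_def]] .
  moreover have "d > 0" by (simp add: d_def)
  ultimately show ?thesis
    by (metis dvd_eq_mod_eq_0 funpow_0 funpow_mod_eq gr0I mod_less_divisor)
qed

lemma orbit_representatives:
  assumes "permutation y"
  shows "\<exists>R\<subseteq>{s. y s \<noteq> s}. (\<forall>s. y s \<noteq> s \<longrightarrow> (\<exists>r\<in>R. s \<in> Orbits.orbit y r)) \<and>
    (\<forall>r\<in>R. \<forall>r'\<in>R. r' \<in> Orbits.orbit y r \<longrightarrow> r' = r)"
proof -
  note self = permutation_self_in_orbit[OF assms]
  \<comment> \<open>The choice depends on the orbit only as a set, so all points of one cycle get
    the same representative.\<close>
  define rep where "rep s = (SOME t. t \<in> Orbits.orbit y s)" for s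
  have rep: "rep s \<in> Orbits.orbit y s" for s
    unfolding rep_def using self by (rule someI)
  have eq: "Orbits.orbit y t = Orbits.orbit y s" if "t \<in> Orbits.orbit y s" for s t
    by (rule orbit_cyclic_eq3[OF cyclic_on_orbit'[OF assms] that])
  have fixed: "Orbits.orbit y s = {s} \<longleftrightarrow> y s = s" for s by (rule orbit_eq_singleton_iff)
  show ?thesis
  proof (intro exI[of _ "rep ` {s. y s \<noteq> s}"] conjI allI impI ballI)
    show "rep ` {s. y s \<noteq> s} \<subseteq> {s. y s \<noteq> s}"
    proof safe
      fix s assume "y (rep s) = rep s" "y s \<noteq> s"
      then show False using eq[OF rep, of s] fixed[of "rep s"] fixed[of s] self[of s] by auto
    qed
    show "\<exists>r\<in>rep ` {s. y s \<noteq> s}. s \<in> Orbits.orbit y r" if "y s \<noteq> s" for s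
      using that eq[OF rep, of s] self[of s] by blast
    show "r' = r" if rr': "r \<in> rep ` {s. y s \<noteq> s}" "r' \<in> rep ` {s. y s \<noteq> s}"
      "r' \<in> Orbits.orbit y r" for r r'
    proof -
      obtain s s' where s: "r = rep s" "r' = rep s'" using rr' by blast
      have "Orbits.orbit y s = Orbits.orbit y s'" using eq rr'(3) rep s by metis
      then show ?thesis by (simp add: s rep_def)
    qed
  qed
qed

section \<open>Powers of a permutation that commute with a suitable conjugate of it\<close>

lemma funpow_commute: "(f ^^ m) ((f ^^ n) x) = (f ^^ n) ((f ^^ m) x)"
  by (metis add.commute comp_apply funpow_add)

lemma funpow_fixed: "f x = x \<Longrightarrow> (f ^^ n) x = x"
  by (induction n) auto

lemma funpow_fixed_on_orbit:
  assumes "permutation y" "(y ^^ k) s = s" "t \<in> Orbits.orbit y s"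
  shows "(y ^^ k) t = t"
proof -
  obtain n where "t = (y ^^ n) s" using assms by (auto simp: orbit_altdef)
  then show ?thesis using assms funpow_commute by metis
qed

text \<open>Conjugating the relation \<open>comm\<close> by \<open>f\<close> turns it into
  commutation with \<open>y\<close> itself, whose cycles are known.\<close>

lemma funpow_commutes_conj_imp:
  assumes f: "bij f" and comm: "(y ^^ k) \<circ> (f \<circ> y \<circ> inv' f) = (f \<circ> y \<circ> inv' f) \<circ> (y ^^ k)"
  shows "inv' f ((y ^^ k) (f (y t))) = y (inv' f ((y ^^ k) (f t)))"
proof -
  have "(y ^^ k) (f (y t)) = f (y (inv' f ((y ^^ k) (f t))))"
    using fun_cong[OF comm, of "f t"] f by (simp add: bij_is_inj)
  then show ?thesis using f by (simp add: bij_is_inj)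
qed

text \<open>\<open>R\<close> represents the nontrivial cycles of \<open>y\<close>, and
  \<open>min\<close> makes \<open>f\<close> a single cycle on \<open>R\<close>. The argument splits
  on whether \<open>z = y ^^ k\<close> moves all of \<open>R\<close>.\<close>

lemma funpow_commuting_with_cyclic_conj:
  assumes y: "permutation y"
    and moved: "R \<subseteq> {s. y s \<noteq> s}"
    and cover: "\<And>s. y s \<noteq> s \<Longrightarrow> \<exists>r\<in>R. s \<in> Orbits.orbit y r"
    and uniq: "\<And>r r'. r \<in> R \<Longrightarrow> r' \<in> R \<Longrightarrow> r' \<in> Orbits.orbit y r \<Longrightarrow> r' = r"
    and f: "f permutes R"
    and min: "\<And>P. P \<subseteq> R \<Longrightarrow> P \<noteq> {} \<Longrightarrow> f ` P \<subseteq> P \<Longrightarrow> P = R"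
    and R: "\<And>r. R \<noteq> {r}"
    and y2: "y ^^ 2 \<noteq> id"
    and comm: "(y ^^ k) \<circ> (f \<circ> y \<circ> inv' f) = (f \<circ> y \<circ> inv' f) \<circ> (y ^^ k)"
  shows "y ^^ k = id"
proof (rule ccontr)
  assume nontriv: "y ^^ k \<noteq> id"
  define z where "z = y ^^ k"
  define g where "g = inv' f"
  note self = permutation_self_in_orbit[OF y]
  have bij_y: "bij y" using y by (rule permutation_bijective)
  have bij_f: "bij f" using f by (rule permutes_bij)
  have fg: "f (g s) = s" and gf: "g (f s) = s" for s
    using bij_f by (simp_all add: g_def bij_is_inj bij_is_surj surj_f_inv_f)
  have f_out: "f s = s" and g_out: "g s = s" if "s \<notin> R" for s
    using f that permutes_inv[OF f] by (auto simp: permutes_not_in g_def)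
  have f_in: "f s \<in> R \<longleftrightarrow> s \<in> R" for s
    using permutes_in_image[OF f] .
  have z'y: "g (z (f (y t))) = y (g (z (f t)))" for t
    unfolding z_def g_def by (rule funpow_commutes_conj_imp[OF bij_f comm])
  have zy: "z (y s) = y (z s)" for s
    using funpow_swap1[of y k s] by (simp add: z_def)
  have z_orbit: "z s \<in> Orbits.orbit y r" if "s \<in> Orbits.orbit y r" for s r
    unfolding z_def using that by (rule funpow_in_orbit)
  have y_orbit: "y s \<in> Orbits.orbit y r" if "s \<in> Orbits.orbit y r" for s r
    using that by (rule orbit.step)
  have y_inj: "y s = y t \<longleftrightarrow> s = t" for s t using bij_y by (simp add: bij_is_inj inj_eq)
  have y_out: "y r \<notin> R" if "r \<in> R" for r
    using uniq[of r "y r"] moved that y_orbit[OF self] by auto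
  have fr: "f r \<noteq> r" if "r \<in> R" for r
    using min[of "{r}"] R that by auto
  have eqr: "r = r'" if "r \<in> R" "r' \<in> R" "s \<in> Orbits.orbit y r" "s \<in> Orbits.orbit y r'" for r r' s
    by (metis that self uniq y cyclic_on_orbit' orbit_cyclic_eq3)
  \<comment> \<open>A power of \<open>y\<close> that fixes one point of a cycle fixes all of it, so
    \<open>P\<close> records the cycles on which \<open>z\<close> acts nontrivially.\<close>
  define P where "P = {r \<in> R. z r \<noteq> r}"
  have "P \<noteq> {}"
  proof -
    obtain s where s: "z s \<noteq> s" using nontriv by (auto simp: z_def fun_eq_iff)
    then have "y s \<noteq> s" by (metis funpow_fixed z_def)
    then obtain r where "r \<in> R" "s \<in> Orbits.orbit y r" using cover by blast
    then show ?thesis using s funpow_fixed_on_orbit[OF y, of k r s] by (auto simp: P_def z_def)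
  qed
  show False
  proof (cases "P = R")
    case False
    \<comment> \<open>The support of \<open>g z f\<close> omits \<open>r\<close> but not \<open>y r\<close>, so it is not invariant under \<open>y\<close>.\<close>
    then obtain r where r: "r \<in> P" "f r \<notin> P" using min[of P] \<open>P \<noteq> {}\<close> by (auto simp: P_def)
    then have rR: "r \<in> R" and zr: "z r \<noteq> r" and zf: "z (f r) = f r"
      using f_in by (auto simp: P_def)
    have yr: "f (y r) = y r" using f_out y_out rR by blast
    have "g (z (y r)) = y r" using z'y[of r] yr zf gf by simp
    then have "z (y r) = y r" using fg[of "z (y r)"] yr by simp
    then show False using zr zy y_inj by simp
  next
    case True
    \<comment> \<open>Off \<open>R\<close>, \<open>g z f\<close> acts as \<open>z\<close> unless \<open>z\<close> leads into \<open>R\<close>, whereas it maps \<open>r\<close> into the cycle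
      of \<open>f r\<close>. Following \<open>y r\<close> and \<open>y (y r)\<close>, this is only consistent if the cycle has length \<open>2\<close>.\<close>
    have z_out: "z r \<notin> R" if "r \<in> R" for r
      using uniq[of r "z r"] True that z_orbit[OF self] by (auto simp: P_def)
    have key: "z (y r) = r \<and> y (y r) = r" if r: "r \<in> R" for r
    proof -
      have fR: "f r \<in> R" using r f_in by blast
      have z'r: "g (z (f r)) = z (f r)" using z_out[OF fR] g_out by blast
      have yr: "f (y r) = y r" using f_out y_out r by blast
      have 1: "g (z (y r)) = y (z (f r))" using z'y[of r] yr z'r by simp
      have zyr: "z (y r) \<in> R"
      proof (rule ccontr)
        assume "z (y r) \<notin> R"
        then have "z (y r) = y (z (f r))" using 1 g_out by simp
        \<comment> \<open>The two sides lie in the cycles of \<open>r\<close> and of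
          \<open>f r\<close>, so these cycles coincide and have the same representative.\<close>
        then have "f r = r"
          by (metis eqr fR r self y_orbit z_orbit)
        then show False using fr r by blast
      qed
      then have zyr': "z (y r) = r" using uniq r z_orbit[OF y_orbit[OF self]] by blast
      have "y (y r) = r"
      proof (rule ccontr)
        assume "y (y r) \<noteq> r"
        then have "y (y r) \<notin> R" using uniq r y_orbit[OF y_orbit[OF self]] by blast
        then have "g (z (y (y r))) = y (y (z (f r)))" using z'y[of "y r"] yr 1 f_out by simp
        moreover have "z (y (y r)) = y r" using zy[of "y r"] zyr' by simp
        ultimately have "y r = y (y (z (f r)))" using g_out[OF y_out[OF r]] by simp
        then have "f r = r"
          by (metis eqr fR r self y_orbit z_orbit)
        then show False using fr r by blast
      qed
      then show ?thesis using zyr' by blast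
    qed
    have "(y ^^ 2) s = s" for s
    proof (cases "y s = s")
      case False
      then obtain r where "r \<in> R" "s \<in> Orbits.orbit y r" using cover by blast
      then show ?thesis using funpow_fixed_on_orbit[OF y, of 2 r s] key[of r]
        by (simp add: numeral_2_eq_2)
    qed (simp add: numeral_2_eq_2)
    then show False using y2 by (auto simp: fun_eq_iff)
  qed
qed

lemma funpow_commuting_with_transposed_cycle:
  assumes y: "permutation y"
    and cyc: "\<And>s. y s \<noteq> s \<Longrightarrow> s \<in> Orbits.orbit y a"
    and ne: "\<And>m. m \<in> {1,2,3,4} \<Longrightarrow> y ^^ m \<noteq> id"
    and f: "f = transpose a (y a)"
    and comm: "(y ^^ k) \<circ> (f \<circ> y \<circ> inv' f) = (f \<circ> y \<circ> inv' f) \<circ> (y ^^ k)"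
  shows "y ^^ k = id"
proof (rule ccontr)
  assume nontriv: "y ^^ k \<noteq> id"
  define z where "z = y ^^ k"
  have "bij f" unfolding f by simp
  have "inv' f = f" unfolding f by simp
  have bij_y: "bij y" using y by (rule permutation_bijective)
  have bij_z: "bij z" unfolding z_def using bij_y by (rule bij_fn)
  have z'y: "f (z (f (y t))) = y (f (z (f t)))" for t
    using funpow_commutes_conj_imp[OF \<open>bij f\<close> comm, of t] \<open>inv' f = f\<close> by (simp add: z_def)
  have zy: "z (y s) = y (z s)" for s
    using funpow_swap1[of y k s] by (simp add: z_def)
  \<comment> \<open>All points moved by \<open>y\<close> lie on the cycle of \<open>a\<close>, so
    \<open>a\<close> alone decides whether a power is trivial.\<close>
  have all: "y ^^ m = id" if "(y ^^ m) a = a" for m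
  proof
    fix s
    show "(y ^^ m) s = id s"
      using cyc[of s] funpow_fixed_on_orbit[OF y that, of s] funpow_fixed[of y s m] by auto
  qed
  have za: "z a \<noteq> a" using all[of k] nontriv by (auto simp: z_def)
  have nm: "(y ^^ m) a \<noteq> a" if "m \<in> {1,2,3,4}" for m using ne[OF that] all by blast
  have inj: "inj_on (\<lambda>j. (y ^^ j) a) {..<5}"
  proof (rule linorder_inj_onI)
    fix i j :: nat assume ij: "i < j" "i \<in> {..<5}" "j \<in> {..<5}"
    have "(y ^^ i) a \<noteq> (y ^^ i) ((y ^^ (j - i)) a)"
    proof -
      have "j - i \<in> {1,2,3,4}" using ij by auto
      moreover have "inj (y ^^ i)" using bij_fn[OF bij_y] bij_is_inj by blast
      ultimately show ?thesis using nm by (metis injD)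
    qed
    then show "(y ^^ i) a \<noteq> (y ^^ j) a" using funpow_add[of i "j - i" y] ij by simp
  qed auto
  \<comment> \<open>Outside \<open>B\<close>, the transposition \<open>f\<close> fixes both
    \<open>s\<close> and \<open>z s\<close>, so \<open>f z f\<close> agrees with \<open>z\<close> at
    \<open>s\<close>. As the cycle has at least five points, it leaves \<open>B\<close>.\<close>
  define B where "B = {a, y a, inv' z a, inv' z (y a)}"
  have "\<not> (\<lambda>j. (y ^^ j) a) ` {..<5} \<subseteq> B"
  proof
    assume "(\<lambda>j. (y ^^ j) a) ` {..<5} \<subseteq> B"
    then have "card {..<5::nat} \<le> card B" using inj
      by (intro card_inj_on_le) (auto simp: B_def)
    moreover have "card B \<le> 4" unfolding B_def by (simp add: card_insert_if)
    ultimately show False by simp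
  qed
  then obtain s j where s: "s = (y ^^ j) a" "s \<notin> B" by blast
  have zB: "z s \<notin> {a, y a}"
    using s(2) inv_f_f[OF bij_is_inj[OF bij_z], of s] by (auto simp: B_def)
  have "f (z (f s)) = z s" using s zB by (auto simp: f B_def)
  \<comment> \<open>Both \<open>f z f\<close> and \<open>z\<close> commute with \<open>y\<close>, so
    agreement at \<open>s\<close> spreads along the whole cycle, in particular to
    \<open>a\<close>.\<close>
  then have iter: "f (z (f ((y ^^ n) s))) = z ((y ^^ n) s)" for n
    by (induction n) (simp_all add: z'y zy)
  have "a \<in> Orbits.orbit y s"
    using s y by (metis funpow_in_orbit orbit_swap permutation_self_in_orbit)
  then obtain n where n: "a = (y ^^ n) s" by (auto simp: orbit_altdef)
  have "f (z (f a)) = z a" using iter[of n] n by simp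
  then have "f (y (z a)) = z a" by (simp add: f zy)
  moreover have "y (z a) \<noteq> z a" using nm[of 1]
    by (simp add: inj_eq[OF bij_is_inj[OF bij_z]] flip: zy)
  \<comment> \<open>Since \<open>f\<close> maps \<open>y (z a)\<close> to the different point
    \<open>z a\<close>, these two points are \<open>a\<close> and \<open>y a\<close> in some order;
    \<open>za\<close> settles which is which.\<close>
  ultimately have "z a = y a \<and> y (z a) = a" using za
    by (auto simp: f transpose_def split: if_splits)
  then show False using nm[of 2] by (auto simp: numeral_2_eq_2)
qed

proposition exists_conj_with_trivial_commuting_powers:
  assumes "finite S" "y permutes S" and ne: "\<And>m. m \<in> {1,2,3,4} \<Longrightarrow> y ^^ m \<noteq> id"
  obtains f where "f permutes S"
    "\<And>k. (y ^^ k) \<circ> (f \<circ> y \<circ> inv' f) = (f \<circ> y \<circ> inv' f) \<circ> (y ^^ k) \<Longrightarrow> y ^^ k = id"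
proof -
  have y: "permutation y" using assms permutation_permutes by blast
  obtain R where R: "R \<subseteq> {s. y s \<noteq> s}"
    "\<And>s. y s \<noteq> s \<Longrightarrow> \<exists>r\<in>R. s \<in> Orbits.orbit y r"
    "\<And>r r'. r \<in> R \<Longrightarrow> r' \<in> R \<Longrightarrow> r' \<in> Orbits.orbit y r \<Longrightarrow> r' = r"
    using orbit_representatives[OF y] by metis
  have RS: "R \<subseteq> S" using R(1) assms(2) by (auto simp: permutes_def)
  have "R \<noteq> {}" using R(2) ne[of 1] by (auto simp: fun_eq_iff)
  show ?thesis
  proof (cases "\<exists>a. R = {a}")
    case True
    then obtain a where a: "R = {a}" by blast
    then have "a \<in> S" "y a \<in> S" using RS assms(2) by (auto simp: permutes_in_image)
    moreover have "s \<in> Orbits.orbit y a" if "y s \<noteq> s" for s using R(2) that a by auto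
    ultimately show ?thesis
      using that[of "transpose a (y a)"] permutes_swap_id ne
        funpow_commuting_with_transposed_cycle[OF y, of a] by metis
  next
    case False
    obtain f where f: "f permutes R"
      "\<And>P. P \<subseteq> R \<Longrightarrow> P \<noteq> {} \<Longrightarrow> f ` P \<subseteq> P \<Longrightarrow> P = R"
      using exists_cyclic_permutation[of R] \<open>R \<noteq> {}\<close> finite_subset[OF RS assms(1)] by metis
    show ?thesis
    proof (rule that[of f])
      show "f permutes S" using f RS by (meson permutes_subset)
      show "y ^^ k = id"
        if "(y ^^ k) \<circ> (f \<circ> y \<circ> inv' f) = (f \<circ> y \<circ> inv' f) \<circ> (y ^^ k)" for k
        by (rule funpow_commuting_with_cyclic_conj[OF y R f _ _ that]) (use False ne in auto)
    qed
  qed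
qed

section \<open>Conjugacy classes and the conjugation quandle\<close>

lemma conjugacy_classes_closed:
  assumes "group G" "A \<in> conjugacy_classes G"
  shows "A \<subseteq> carrier G"
    and "\<lbrakk>x \<in> A; g \<in> carrier G\<rbrakk> \<Longrightarrow> g \<otimes>\<^bsub>G\<^esub> x \<otimes>\<^bsub>G\<^esub> inv\<^bsub>G\<^esub> g \<in> A"
proof -
  interpret group G by fact
  obtain h where h: "h \<in> carrier G" "A = {g \<otimes>\<^bsub>G\<^esub> h \<otimes>\<^bsub>G\<^esub> inv\<^bsub>G\<^esub> g |g. g \<in> carrier G}"
    using assms(2) by (auto simp: conjugacy_classes_def orbits_def Group_Action.orbit_def)
  show "A \<subseteq> carrier G" using h by auto
  assume "x \<in> A" and g: "g \<in> carrier G"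
  then obtain k where k: "k \<in> carrier G" "x = k \<otimes>\<^bsub>G\<^esub> h \<otimes>\<^bsub>G\<^esub> inv\<^bsub>G\<^esub> k" using h by blast
  then have "g \<otimes>\<^bsub>G\<^esub> x \<otimes>\<^bsub>G\<^esub> inv\<^bsub>G\<^esub> g = (g \<otimes>\<^bsub>G\<^esub> k) \<otimes>\<^bsub>G\<^esub> h \<otimes>\<^bsub>G\<^esub> inv\<^bsub>G\<^esub> (g \<otimes>\<^bsub>G\<^esub> k)"
    using g h by (simp add: m_assoc inv_mult_group)
  then show "g \<otimes>\<^bsub>G\<^esub> x \<otimes>\<^bsub>G\<^esub> inv\<^bsub>G\<^esub> g \<in> A" using g k h(2) by blast
qed

lemma finite_quandle_conj_quandle:
  assumes "group G" "finite C" "C \<subseteq> carrier G"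
    and closed: "\<And>x g. \<lbrakk>x \<in> C; g \<in> carrier G\<rbrakk> \<Longrightarrow> g \<otimes>\<^bsub>G\<^esub> x \<otimes>\<^bsub>G\<^esub> inv\<^bsub>G\<^esub> g \<in> C"
  shows "finite_quandle (conj_quandle G C)"
proof -
  interpret group G by fact
  note C = subsetD[OF assms(3)]
  show ?thesis
  proof (unfold_locales, simp_all add: conj_quandle_def assms(2) closed C)
    show "x \<otimes>\<^bsub>G\<^esub> x \<otimes>\<^bsub>G\<^esub> inv\<^bsub>G\<^esub> x = x" if "x \<in> C" for x
      using C[OF that] by (simp add: m_assoc)
  next
    fix y assume y: "y \<in> C"
    define r where "r = right_translation \<lparr>elts = C, op = \<lambda>x y. y \<otimes>\<^bsub>G\<^esub> x \<otimes>\<^bsub>G\<^esub> inv\<^bsub>G\<^esub> y\<rparr> y"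
    have r: "r x = (if x \<in> C then y \<otimes>\<^bsub>G\<^esub> x \<otimes>\<^bsub>G\<^esub> inv\<^bsub>G\<^esub> y else x)" for x
      by (simp add: r_def right_translation_def perm_restrict_def)
    have "inj_on r C" using y C by (auto simp: inj_on_def r)
    moreover have "r ` C \<subseteq> C" using y C closed by (auto simp: r)
    ultimately have "bij_betw r C C"
      using assms(2) by (simp add: bij_betw_def endo_inj_surj)
    then show "r permutes C" by (rule bij_imp_permutes) (simp add: r)
  next
    fix x y z assume "x \<in> C" "y \<in> C" "z \<in> C"
    then have x: "x \<in> carrier G" and y: "y \<in> carrier G" and z: "z \<in> carrier G" using C by auto
    \<comment> \<open>After reassociation to the right, each inner factor \<open>inv z\<close> meets
      a \<open>z\<close>, and this rule cancels the pair.\<close>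
    have canc: "inv\<^bsub>G\<^esub> z \<otimes>\<^bsub>G\<^esub> (z \<otimes>\<^bsub>G\<^esub> a) = a" if "a \<in> carrier G" for a
      using that z by (simp flip: m_assoc)
    show "z \<otimes>\<^bsub>G\<^esub> (y \<otimes>\<^bsub>G\<^esub> x \<otimes>\<^bsub>G\<^esub> inv\<^bsub>G\<^esub> y) \<otimes>\<^bsub>G\<^esub> inv\<^bsub>G\<^esub> z =
      z \<otimes>\<^bsub>G\<^esub> y \<otimes>\<^bsub>G\<^esub> inv\<^bsub>G\<^esub> z \<otimes>\<^bsub>G\<^esub> (z \<otimes>\<^bsub>G\<^esub> x \<otimes>\<^bsub>G\<^esub> inv\<^bsub>G\<^esub> z) \<otimes>\<^bsub>G\<^esub>
        inv\<^bsub>G\<^esub> (z \<otimes>\<^bsub>G\<^esub> y \<otimes>\<^bsub>G\<^esub> inv\<^bsub>G\<^esub> z)"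
      using x y z by (simp add: m_assoc inv_mult_group canc)
  qed
qed

section \<open>Regularity of the right translations\<close>

text \<open>Apart from \<open>1\<close> and \<open>m\<close>, the only possible divisor is
  \<open>2\<close> for \<open>m = 4\<close>, so the divisors form a chain. This fails for
  \<open>m = 6\<close>.\<close>

lemma dvd_if_le_if_both_dvd_at_most_4:
  fixes a b m :: nat
  assumes "m \<in> {1,2,3,4}" "a dvd m" "b dvd m" "a \<le> b"
  shows "a dvd b"
proof -
  have *: "d = 1 \<or> d = m \<or> (m = 4 \<and> d = 2)" if "d dvd m" for d
  proof -
    have "d \<le> 4" "d > 0" using dvd_imp_le[OF that] dvd_pos_nat[OF _ that] assms(1) by auto
    then have "d \<in> {1,2,3,4}" by auto
    then show ?thesis using that assms(1) by auto
  qed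
  show ?thesis using *[OF assms(2)] *[OF assms(3)] assms by auto
qed

theorem theorem3p2:
  fixes n :: nat and I :: "'i set" and C :: "'i \<Rightarrow> (nat \<Rightarrow> nat) set"
  assumes "\<And>i. i \<in> I \<Longrightarrow> C i \<in> conjugacy_classes (sym_group n)"
  shows "hayashi (conj_quandle (sym_group n) (\<Union>i\<in>I. C i))"
proof -
  define D where "D = (\<Union>i\<in>I. C i)"
  define Q where "Q = conj_quandle (sym_group n) D"
  have D_carrier: "D \<subseteq> carrier (sym_group n)"
    unfolding D_def using conjugacy_classes_closed(1)[OF sym_group_is_group] assms by blast
  then have D_perm: "x permutes {1..n}" if "x \<in> D" for x
    using that by (auto simp: sym_group_carrier)
  have D_closed: "g \<otimes>\<^bsub>sym_group n\<^esub> x \<otimes>\<^bsub>sym_group n\<^esub> inv\<^bsub>sym_group n\<^esub> g \<in> D"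
    if "x \<in> D" "g \<in> carrier (sym_group n)" for x g
    using that conjugacy_classes_closed(2)[OF sym_group_is_group] assms unfolding D_def by blast
  then have D_conj: "g \<circ> x \<circ> inv' g \<in> D" if "x \<in> D" "g permutes {1..n}" for x g
    using that by (metis sym_group_carrier sym_group_inv_equality sym_group_mult)
  have "finite D" using D_perm finite_permutations[of "{1..n}"]
    by (metis finite_atLeastAtMost finite_subset mem_Collect_eq subsetI)
  then have quandle: "finite_quandle Q"
    unfolding Q_def using finite_quandle_conj_quandle sym_group_is_group D_carrier D_closed by blast
  have elts: "elts Q = D" by (simp add: Q_def conj_quandle_def)
  have "regular_permutation (right_translation Q y) D" if y: "y \<in> D" for y
  proof -
    define r where "r = right_translation Q y"
    have r_perm: "r permutes D"
      using finite_quandle.right_translation_permutes[OF quandle, of y] y by (simp add: elts r_def)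
    have y_perm: "y permutes {1..n}" using D_perm y .
    have bij_y: "bij y" using y_perm by (rule permutes_bij)
    \<comment> \<open>Conjugation by \<open>y\<close> is stated without inverses, so that iterating
      it in \<open>r_pow\<close> only needs associativity.\<close>
    have r: "r x \<circ> y = y \<circ> x" if "x \<in> D" for x
    proof -
      have "r x = y \<circ> x \<circ> inv' y"
        using that y D_carrier unfolding r_def right_translation_def Q_def
        by (simp add: conj_quandle_def perm_restrict_def sym_group_mult subsetD)
      then show ?thesis using bij_y by (simp add: comp_assoc bij_is_inj)
    qed
    have r_pow: "(r ^^ k) x \<in> D \<and> (r ^^ k) x \<circ> y ^^ k = y ^^ k \<circ> x" if "x \<in> D" for x k
    proof (induction k)
      case (Suc k)
      then have "(r ^^ Suc k) x \<circ> y ^^ Suc k = r ((r ^^ k) x) \<circ> y \<circ> y ^^ k"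
        by (simp add: comp_assoc)
      also have "\<dots> = y \<circ> ((r ^^ k) x \<circ> y ^^ k)" using Suc r by (simp add: comp_assoc)
      also have "\<dots> = y ^^ Suc k \<circ> x" by (simp only: conjunct2[OF Suc] comp_assoc funpow.simps)
      finally show ?case using Suc permutes_in_image[OF r_perm] by (metis comp_apply funpow.simps(2))
    qed (simp add: that)
    have r_pow_fixed: "(r ^^ k) x = x \<longleftrightarrow> y ^^ k \<circ> x = x \<circ> y ^^ k" if "x \<in> D" for x k
    proof
      assume "y ^^ k \<circ> x = x \<circ> y ^^ k"
      then have "(r ^^ k) x \<circ> y ^^ k = x \<circ> y ^^ k" using r_pow[OF that] by simp
      moreover have "surj (y ^^ k)" using bij_y by (simp add: bij_fn bij_is_surj)
      ultimately show "(r ^^ k) x = x" by (metis comp_assoc comp_id surj_iff)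
    qed (use r_pow[OF that, of k] in simp)
    define len where "len x = card (Orbits.orbit r x)" for x
    have "permutation r" using r_perm \<open>finite D\<close> permutation_permutes by blast
    then have len_dvd: "len x dvd k \<longleftrightarrow> y ^^ k \<circ> x = x \<circ> y ^^ k" if "x \<in> D" for x k
      unfolding len_def using that by (simp add: card_orbit_dvd_iff r_pow_fixed)
    have "finite (len ` D)" using \<open>finite D\<close> by simp
    have "len x dvd Max (len ` D)" if x: "x \<in> D" for x
    proof (cases "\<exists>m\<in>{1,2,3,4}. y ^^ m = id")
      case True
      then obtain m where m: "m \<in> {1,2,3,4}" "y ^^ m = id" by blast
      \<comment> \<open>The identity \<open>y ^^ m\<close> commutes with everything, so every cycle
        length divides \<open>m\<close>, and the largest one is a multiple of the others.\<close>
      then have "len z dvd m" if "z \<in> D" for z using that len_dvd by simp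
      moreover obtain z where "z \<in> D" "Max (len ` D) = len z"
        using Max_in[OF \<open>finite (len ` D)\<close>] x by blast
      moreover have "len x \<le> Max (len ` D)" using \<open>finite (len ` D)\<close> x by simp
      ultimately show ?thesis using dvd_if_le_if_both_dvd_at_most_4[OF m(1)] x by metis
    next
      case False
      obtain f where f: "f permutes {1..n}"
        "\<And>k. (y ^^ k) \<circ> (f \<circ> y \<circ> inv' f) = (f \<circ> y \<circ> inv' f) \<circ> (y ^^ k) \<Longrightarrow> y ^^ k = id"
        using exists_conj_with_trivial_commuting_powers[OF _ y_perm] False
        by (metis finite_atLeastAtMost)
      define w where "w = f \<circ> y \<circ> inv' f"
      have w: "w \<in> D" unfolding w_def using D_conj y f(1) by blast
      \<comment> \<open>Taking \<open>k = len w\<close> in \<open>len_dvd\<close> makes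
        \<open>y ^^ len w\<close> commute with \<open>w\<close>, hence trivial; then every cycle
        length divides \<open>len w\<close>, which is therefore the maximum.\<close>
      have "y ^^ len w \<circ> w = w \<circ> y ^^ len w" by (rule iffD1[OF len_dvd[OF w] dvd_refl])
      then have "y ^^ len w = id" by (rule f(2)[folded w_def])
      then have dvd: "len z dvd len w" if "z \<in> D" for z using len_dvd[OF that] by simp
      moreover have "len w > 0" using \<open>permutation r\<close> unfolding len_def
        by (simp add: card_gt_0_iff finite_orbit orbit_nonempty permutation_self_in_orbit)
      ultimately have "Max (len ` D) = len w"
        using w \<open>finite (len ` D)\<close> by (intro Max_eqI) (auto intro: dvd_imp_le)
      then show ?thesis using dvd x by simp
    qed
    then show ?thesis
      using \<open>finite D\<close> r_perm
      by (auto simp: regular_permutation_def cycle_lengths_def simp flip: r_def len_def)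
  qed
  then show ?thesis
    using quandle elts by (simp add: hayashi_def Q_def D_def)
qed

end
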